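(* Consider the perturbed Kagome lattice with fixed vertex weight $\mu>0$ and monomeric edge weights given by $\alpha,\beta>0$ with $2(\alpha+\beta)=\mu$, i.e. $\gamma_2=\gamma_4=\gamma_6=\alpha$ and $\gamma_1=\gamma_3=\gamma_5=\beta$, and with Laplacian $(\Delta_\gamma f)(v)=f(v)-\frac1\mu\sum_{w\sim v}\gamma_{vw}f(w)$ on $\ell^2(V)$. Then the spectrum of $\Delta_\gamma$ is given by $$\sigma(\Delta_\gamma)=\left[0,\ \frac34-\left|\frac{3\alpha}{\mu}-\frac34\right|\right]\ \cup\ \left[\frac34+\left|\frac{3\alpha}{\mu}-\frac34\right|,\ \frac32\right].$$ Furthermore, there is always a flat band at $\frac32$.
   Context: The Kagome lattice is the Archimedean tiling in which every vertex is surrounded cyclically by triangle, hexagon, triangle, hexagon. As a graph with periodic edge weights it is described as follows. The vertex set is $V=\{v_j+\beta : j\in\{1,2,3\},\ \beta\in\mathbb{Z}^2\}$ (disjoint translates of three vertices), with translations $T_{\beta'}(v_j+\beta)=v_j+\beta+\beta'$; write $\omega_1=(1,0)$, $\omega_2=(0,1)$. The edges are the $\mathbb{Z}^2$-translates of the following six edges, with the weights indicated (symmetric and constant along translates): $v_1\sim v_3+\omega_2$ (weight $\gamma_1$), $v_2\sim v_3$ (weight $\gamma_2$), $v_1\sim v_2$ (weight $\gamma_3$), $v_1\sim v_3+\omega_1$ (weight $\gamma_4$), $v_2\sim v_3+\omega_2$ (weight $\gamma_5$), $v_1\sim v_2+\omega_1$ (weight $\gamma_6$). The edges with weights $\gamma_2,\gamma_4,\gamma_6$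 form the triangles of one orientation and those with weights $\gamma_1,\gamma_3,\gamma_5$ the triangles of the other orientation. Flat bands: for $\theta\in\mathbb{R}^2$ let $\ell^2(V)_\theta=\{f:V\to\mathbb{C}: f(T_\beta v)=e^{i\langle\theta,\beta\rangle}f(v)\ \text{for all } v\in V,\ \beta\in\mathbb{Z}^2\}$ (3-dimensional) and let $\Delta_\gamma^\theta$ be the operator on $\ell^2(V)_\theta$ given by the same formula as $\Delta_\gamma$. $\Delta_\gamma$ has a flat band at energy $E\in\mathbb{R}$ if $E\in\sigma(\Delta_\gamma^\theta)$ for all $\theta$ (equivalently, there is an infinite orthonormal family of eigenfunctions of $\Delta_\gamma$ in $\ell^2(V)$ to the eigenvalue $E$). *)

theory Defs
  imports "HOL-Analysis.Analysis"
begin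

section \<open>The Kagome lattice as a periodic weighted graph\<close>

datatype site = V1 | V2 | V3

text \<open>The pair \<open>(j, \<beta>)\<close> stands for the vertex \<open>v\<^sub>j + \<beta>\<close>.\<close>
type_synonym vertex = "site \<times> (int \<times> int)"

definition translate :: "int \<times> int \<Rightarrow> vertex \<Rightarrow> vertex" where
  "translate \<beta> v = (fst v, snd v + \<beta>)"

text \<open>The six edges of a fundamental cell; the first component is the index of the edge weight.\<close>
definition base_edges :: "(nat \<times> vertex \<times> vertex) set" where
  "base_edges =
    {(1, (V1, (0, 0)), (V3, (0, 1))),
     (2, (V2, (0, 0)), (V3, (0, 0))),
     (3, (V1, (0, 0)), (V2, (0, 0))),
     (4, (V1, (0, 0)), (V3, (1, 0))),
     (5, (V2, (0, 0)), (V3, (0, 1))),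
     (6, (V1, (0, 0)), (V2, (1, 0)))}"

definition kagome_edge :: "nat \<Rightarrow> vertex \<Rightarrow> vertex \<Rightarrow> bool" where
  "kagome_edge k v w \<longleftrightarrow>
    (\<exists>a b \<beta>. (k, a, b) \<in> base_edges \<and> {v, w} = {translate \<beta> a, translate \<beta> b})"

definition kagome_adj :: "vertex \<Rightarrow> vertex \<Rightarrow> bool" where
  "kagome_adj v w \<longleftrightarrow> (\<exists>k. kagome_edge k v w)"

text \<open>The graph is simple: the sum has exactly one term if \<open>v\<close> and \<open>w\<close> are adjacent,
  and none otherwise.\<close>
definition edge_weight :: "(nat \<Rightarrow> real) \<Rightarrow> vertex \<Rightarrow> vertex \<Rightarrow> real" where
  "edge_weight \<gamma> v w = (\<Sum>k | kagome_edge k v w. \<gamma> k)"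

definition laplacian :: "real \<Rightarrow> (nat \<Rightarrow> real) \<Rightarrow> (vertex \<Rightarrow> complex) \<Rightarrow> vertex \<Rightarrow> complex" where
  "laplacian \<mu> \<gamma> f v =
    f v - of_real (1 / \<mu>) * (\<Sum>w | kagome_adj v w. of_real (edge_weight \<gamma> v w) * f w)"

section \<open>Spectra of operators on normed spaces of functions\<close>

text \<open>The spectrum of an operator \<open>T\<close> on a space \<open>S\<close> of complex-valued functions with
  norm \<open>N\<close>: the complement of the set of all \<open>z\<close> for which \<open>T - z\<close> is a bijection of \<open>S\<close>
  whose inverse is bounded.\<close>
definition op_spectrum ::
  "('a \<Rightarrow> complex) set \<Rightarrow> (('a \<Rightarrow> complex) \<Rightarrow> real) \<Rightarrow>
   (('a \<Rightarrow> complex) \<Rightarrow> ('a \<Rightarrow> complex)) \<Rightarrow> complex set" where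
  "op_spectrum S N T =
    {z. \<not> (bij_betw (\<lambda>f v. T f v - z * f v) S S \<and>
           (\<exists>C. \<forall>f\<in>S. N f \<le> C * N (\<lambda>v. T f v - z * f v)))}"

definition ell2 :: "('a \<Rightarrow> complex) set" where
  "ell2 = {f. (\<lambda>v. (cmod (f v))\<^sup>2) summable_on UNIV}"

definition ell2_norm :: "('a \<Rightarrow> complex) \<Rightarrow> real" where
  "ell2_norm f = sqrt (\<Sum>\<^sub>\<infinity>v. (cmod (f v))\<^sup>2)"

section \<open>Flat bands\<close>

definition bloch_space :: "real \<times> real \<Rightarrow> (vertex \<Rightarrow> complex) set" where
  "bloch_space \<theta> =
    {f. \<forall>v \<beta>. f (translate \<beta> v) =
      exp (\<i> * of_real (\<theta> \<bullet> (real_of_int (fst \<beta>), real_of_int (snd \<beta>)))) * f v}"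

text \<open>A quasi-periodic function is determined by its values on the fundamental cell. The space
  is three-dimensional, so the choice of norm does not affect the spectrum.\<close>
definition bloch_norm :: "(vertex \<Rightarrow> complex) \<Rightarrow> real" where
  "bloch_norm f = sqrt (\<Sum>j\<in>{V1, V2, V3}. (cmod (f (j, (0, 0))))\<^sup>2)"

definition flat_band :: "real \<Rightarrow> (nat \<Rightarrow> real) \<Rightarrow> real \<Rightarrow> bool" where
  "flat_band \<mu> \<gamma> E \<longleftrightarrow>
    (\<forall>\<theta>. complex_of_real E \<in> op_spectrum (bloch_space \<theta>) bloch_norm (laplacian \<mu> \<gamma>))"

end

theory Submission
  imports Defs
begin

text \<open>
  Let \<open>P\<close> and \<open>Q\<close> sum a function over the triangle of weight \<open>\<alpha>\<close>, respectively \<open>\<beta>\<close>, through the given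
  vertex, and put \<open>a = \<alpha> / \<mu>\<close>, \<open>b = \<beta> / \<mu>\<close>. Then \<open>\<Delta> = 3/2 - a P - b Q\<close>, and \<open>p = P / 3\<close>, \<open>q = Q / 3\<close> are orthogonal
  projections. With \<open>L = \<Delta> - 3/4\<close> and \<open>d = 3 a - 3/4\<close>,
  \<open>L\<^sup>2 = d\<^sup>2 + 9 a b (1 - p - q)\<^sup>2\<close>, \<open>(1 - p - q)\<^sup>2 = 1 - (p - q)\<^sup>2 \<le> 1\<close> and \<open>d\<^sup>2 + 9 a b = (3/4)\<^sup>2\<close>, so
  \<open>\<bar>d\<bar> \<le> \<bar>L\<bar> \<le> 3/4\<close>. Hence \<open>\<Delta> - z\<close> and its adjoint are bounded below, and so invertible,
  unless \<open>z\<close> is real and \<open>\<bar>d\<bar> \<le> \<bar>z - 3/4\<bar> \<le> 3/4\<close>, which describes the two bands.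
  Conversely, Bloch waves along the line \<open>\<theta> = (x, 2 x)\<close> attain all these values, and functions
  with vanishing sum over every triangle have energy \<open>3/2\<close>.
\<close>

section \<open>Square-summable functions as a Hilbert space\<close>

lemma ell2_add:
  assumes "f \<in> ell2" "g \<in> ell2"
  shows "(\<lambda>v. f v + g v) \<in> ell2"
proof -
  have "(\<lambda>v. 2 * (cmod (f v))\<^sup>2 + 2 * (cmod (g v))\<^sup>2) summable_on UNIV"
    using assms by (auto simp: ell2_def intro!: summable_on_add summable_on_cmult_right)
  moreover have "(cmod (a + b))\<^sup>2 \<le> 2 * (cmod a)\<^sup>2 + 2 * (cmod b)\<^sup>2" for a b
    using power_mono[OF norm_triangle_ineq[of a b], of 2] sum_squares_bound[of "cmod a" "cmod b"]
    by (simp add: power2_sum)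
  ultimately show ?thesis
    unfolding ell2_def by (auto intro: summable_on_comparison_test)
qed

lemma ell2_cmult: "f \<in> ell2 \<Longrightarrow> (\<lambda>v. c * f v) \<in> ell2"
  by (auto simp: ell2_def norm_mult power_mult_distrib intro!: summable_on_cmult_right)

lemma ell2_uminus: "f \<in> ell2 \<Longrightarrow> (\<lambda>v. - f v) \<in> ell2"
  by (simp add: ell2_def)

lemma ell2_diff: "f \<in> ell2 \<Longrightarrow> g \<in> ell2 \<Longrightarrow> (\<lambda>v. f v - g v) \<in> ell2"
  using ell2_add[of f "\<lambda>v. - g v"] by (simp add: ell2_uminus)

lemma ell2_comp:
  assumes "f \<in> ell2" "bij p"
  shows "(\<lambda>v. f (p v)) \<in> ell2"
  using assms summable_on_reindex_bij_betw[of p UNIV UNIV "\<lambda>v. (cmod (f v))\<^sup>2"]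
  by (simp add: ell2_def)

lemma ell2_zero: "(\<lambda>v. 0) \<in> ell2"
  by (simp add: ell2_def)

lemma ell2_mult_summable:
  assumes "f \<in> ell2" "g \<in> ell2"
  shows "(\<lambda>v. Re (f v * cnj (g v))) summable_on UNIV"
proof -
  have s: "(\<lambda>v. (cmod (f v))\<^sup>2 + (cmod (g v))\<^sup>2) summable_on UNIV"
    using assms by (auto simp: ell2_def intro!: summable_on_add)
  have "norm (Re (a * cnj b)) \<le> (cmod a)\<^sup>2 + (cmod b)\<^sup>2" for a b
  proof -
    have "norm (Re (a * cnj b)) \<le> cmod a * cmod b"
      by (metis abs_Re_le_cmod complex_mod_cnj norm_mult real_norm_def)
    moreover have "2 * (cmod a * cmod b) \<le> (cmod a)\<^sup>2 + (cmod b)\<^sup>2"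
      using sum_squares_bound[of "cmod a" "cmod b"] by (simp add: mult.assoc)
    moreover have "0 \<le> cmod a * cmod b"
      by simp
    ultimately show ?thesis
      by linarith
  qed
  then show ?thesis
    by (intro iffD2[OF summable_on_iff_abs_summable_on_real Infinite_Sum.abs_summable_on_comparison_test'[OF s]])
qed

text \<open>Square-summable functions become a type so that the theory of complete real inner
  product spaces applies, in particular the Banach fixed point theorem. Scalars are real; the
  complex structure enters separately as \<open>imul\<close>.\<close>

typedef 'a l2 = "ell2 :: ('a \<Rightarrow> complex) set"
  using ell2_zero by blast

setup_lifting type_definition_l2

instantiation l2 :: (type) real_inner
begin

lift_definition zero_l2 :: "'a l2" is "\<lambda>v. 0" by (rule ell2_zero)
lift_definition plus_l2 :: "'a l2 \<Rightarrow> 'a l2 \<Rightarrow> 'a l2" is "\<lambda>f g v. f v + g v" by (rule ell2_add)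
lift_definition minus_l2 :: "'a l2 \<Rightarrow> 'a l2 \<Rightarrow> 'a l2" is "\<lambda>f g v. f v - g v"
  by (rule ell2_diff)
lift_definition uminus_l2 :: "'a l2 \<Rightarrow> 'a l2" is "\<lambda>f v. - f v"
  by (rule ell2_uminus)
lift_definition scaleR_l2 :: "real \<Rightarrow> 'a l2 \<Rightarrow> 'a l2" is "\<lambda>r f v. of_real r * f v"
  by (rule ell2_cmult)
lift_definition inner_l2 :: "'a l2 \<Rightarrow> 'a l2 \<Rightarrow> real" is
  "\<lambda>f g. \<Sum>\<^sub>\<infinity>v. Re (f v * cnj (g v))" .
definition norm_l2 :: "'a l2 \<Rightarrow> real" where "norm_l2 f = sqrt (inner f f)"
definition dist_l2 :: "'a l2 \<Rightarrow> 'a l2 \<Rightarrow> real" where "dist_l2 f g = norm (f - g)"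
definition sgn_l2 :: "'a l2 \<Rightarrow> 'a l2" where "sgn_l2 f = scaleR (inverse (norm f)) f"
definition uniformity_l2 :: "('a l2 \<times> 'a l2) filter" where
  "uniformity_l2 = (INF e\<in>{0<..}. principal {(x, y). dist x y < e})"
definition open_l2 :: "'a l2 set \<Rightarrow> bool" where
  "open_l2 U = (\<forall>x\<in>U. \<forall>\<^sub>F (x', y) in uniformity. x' = x \<longrightarrow> y \<in> U)"

instance
proof
  fix x y z :: "'a l2" and r s :: real
  show "inner x y = inner y x"
    by transfer (simp add: mult.commute)
  show "inner (x + y) z = inner x z + inner y z"
    by transfer (subst infsum_add[symmetric], auto simp: ring_distribs
        simp del: times_complex.simps intro!: ell2_mult_summable)
  show "inner (r *\<^sub>R x) y = r * inner x y"
    by transfer (simp add: infsum_cmult_right'[symmetric] algebra_simps)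
  show "0 \<le> inner x x"
    by transfer (auto intro!: infsum_nonneg)
  show "(inner x x = 0) = (x = 0)"
  proof transfer
    fix f :: "'a \<Rightarrow> complex" assume f: "f \<in> ell2"
    show "((\<Sum>\<^sub>\<infinity>v. Re (f v * cnj (f v))) = 0) = (f = (\<lambda>v. 0))"
    proof
      assume 0: "(\<Sum>\<^sub>\<infinity>v. Re (f v * cnj (f v))) = 0"
      have "Re (f v * cnj (f v)) = 0" for v
        by (rule nonneg_infsum_le_0D[where f = "\<lambda>v. Re (f v * cnj (f v))"])
          (use 0 ell2_mult_summable[OF f f] in auto)
      then show "f = (\<lambda>v. 0)"
        by (auto simp: complex_eq_iff fun_eq_iff add_nonneg_eq_0_iff simp flip: power2_eq_square)
    qed auto
  qed
  show "dist x y = norm (x - y)" by (simp add: dist_l2_def)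
  show "sgn x = scaleR (inverse (norm x)) x" by (simp add: sgn_l2_def)
  show "norm x = sqrt (inner x x)" by (simp add: norm_l2_def)
  show "uniformity = (INF e\<in>{0<..}. principal {(x, y :: 'a l2). dist x y < e})"
    by (simp add: uniformity_l2_def)
  show "open U = (\<forall>x\<in>U. \<forall>\<^sub>F (x', y) in uniformity. x' = x \<longrightarrow> y \<in> U)" for U :: "'a l2 set"
    by (simp add: open_l2_def)
  show "x + y + z = x + (y + z)" "x + y = y + x" "0 + x = x" "- x + x = 0" "x - y = x + - y"
    by (transfer, simp add: add_ac)+
  show "r *\<^sub>R (x + y) = r *\<^sub>R x + r *\<^sub>R y" "(r + s) *\<^sub>R x = r *\<^sub>R x + s *\<^sub>R x"
    "r *\<^sub>R s *\<^sub>R x = (r * s) *\<^sub>R x" "1 *\<^sub>R x = x"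
    by (transfer, simp add: algebra_simps)+
qed

end

section \<open>Completeness of the space of square-summable functions\<close>

lemma norm_eq_ell2_norm: "norm f = ell2_norm (Rep_l2 f)"
  unfolding norm_l2_def ell2_norm_def
  by (transfer, simp add: cmod_power2 flip: power2_eq_square)

lemma norm_l2_point_le: "cmod (Rep_l2 f v) \<le> norm f"
proof -
  have "(\<Sum>v\<in>{v}. (cmod (Rep_l2 f v))\<^sup>2) \<le> (\<Sum>\<^sub>\<infinity>v. (cmod (Rep_l2 f v))\<^sup>2)"
    using Rep_l2[of f] by (intro finite_sum_le_infsum) (auto simp: ell2_def)
  then show ?thesis
    unfolding norm_eq_ell2_norm ell2_norm_def by (simp add: real_le_rsqrt)
qed

lemma norm_l2_sum_le:
  assumes "finite F"
  shows "(\<Sum>v\<in>F. (cmod (Rep_l2 f v))\<^sup>2) \<le> (norm f)\<^sup>2"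
proof -
  have "(\<Sum>v\<in>F. (cmod (Rep_l2 f v))\<^sup>2) \<le> (\<Sum>\<^sub>\<infinity>v. (cmod (Rep_l2 f v))\<^sup>2)"
    using Rep_l2[of f] assms by (intro finite_sum_le_infsum) (auto simp: ell2_def)
  then show ?thesis
    by (simp add: norm_eq_ell2_norm ell2_norm_def infsum_nonneg)
qed

lemma ell2I_bounded:
  assumes "\<And>F. finite F \<Longrightarrow> (\<Sum>v\<in>F. (cmod (f v))\<^sup>2) \<le> C"
  shows "f \<in> ell2" "ell2_norm f \<le> sqrt C"
proof -
  show f: "f \<in> ell2"
    unfolding ell2_def
    by (auto intro!: nonneg_bdd_above_summable_on bdd_aboveI assms)
  show "ell2_norm f \<le> sqrt C"
    using f assms unfolding ell2_norm_def ell2_def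
    by (auto intro!: infsum_le_finite_sums)
qed

instance l2 :: (type) complete_space
proof
  fix X :: "nat \<Rightarrow> 'a l2"
  assume X: "Cauchy X"
  have "Cauchy (\<lambda>n. Rep_l2 (X n) v)" for v
  proof (rule metric_CauchyI)
    fix e :: real assume "0 < e"
    then obtain M where M: "\<And>m n. m \<ge> M \<Longrightarrow> n \<ge> M \<Longrightarrow> dist (X m) (X n) < e"
      using metric_CauchyD[OF X] by blast
    have "dist (Rep_l2 (X m) v) (Rep_l2 (X n) v) \<le> dist (X m) (X n)" for m n
      using norm_l2_point_le[of "X m - X n" v] by (simp add: dist_norm minus_l2.rep_eq)
    with M show "\<exists>M. \<forall>m\<ge>M. \<forall>n\<ge>M. dist (Rep_l2 (X m) v) (Rep_l2 (X n) v) < e"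
      by (meson le_less_trans)
  qed
  then have "\<forall>v. \<exists>l. (\<lambda>n. Rep_l2 (X n) v) \<longlonglongrightarrow> l"
    by (simp add: Cauchy_convergent_iff convergent_def)
  then obtain f where f: "\<And>v. (\<lambda>n. Rep_l2 (X n) v) \<longlonglongrightarrow> f v"
    by metis
  \<comment> \<open>Fatou's argument on finite sets: the bound for \<open>X n - X m\<close> passes
    to the pointwise limit in \<open>m\<close>. Being uniform in \<open>F\<close>, it becomes a norm
    bound by \<open>ell2I_bounded\<close>.\<close>
  have fatou: "(\<Sum>v\<in>F. (cmod (Rep_l2 (X n) v - f v))\<^sup>2) \<le> e\<^sup>2"
    if e: "0 < e" and M: "\<And>m. m \<ge> M \<Longrightarrow> dist (X n) (X m) < e" for F e M n
  proof (rule LIMSEQ_le_const2)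
    show "(\<lambda>m. \<Sum>v\<in>F. (cmod (Rep_l2 (X n) v - Rep_l2 (X m) v))\<^sup>2)
      \<longlonglongrightarrow> (\<Sum>v\<in>F. (cmod (Rep_l2 (X n) v - f v))\<^sup>2)"
      by (intro tendsto_intros f)
    show "\<exists>N. \<forall>m\<ge>N. (\<Sum>v\<in>F. (cmod (Rep_l2 (X n) v - Rep_l2 (X m) v))\<^sup>2) \<le> e\<^sup>2"
    proof (intro exI allI impI)
      fix m assume "M \<le> m"
      then have "(norm (X n - X m))\<^sup>2 \<le> e\<^sup>2"
        using M[of m] by (intro power_mono) (auto simp: dist_norm)
      moreover have "(\<Sum>v\<in>F. (cmod (Rep_l2 (X n) v - Rep_l2 (X m) v))\<^sup>2) \<le> (norm (X n - X m))\<^sup>2"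
      proof (cases "finite F")
        case True
        then show ?thesis
          using norm_l2_sum_le[of F "X n - X m"] by (simp add: minus_l2.rep_eq)
      qed auto
      ultimately show "(\<Sum>v\<in>F. (cmod (Rep_l2 (X n) v - Rep_l2 (X m) v))\<^sup>2) \<le> e\<^sup>2"
        by linarith
    qed
  qed
  have f_ell2: "f \<in> ell2"
  proof -
    obtain M where M: "\<And>m n. m \<ge> M \<Longrightarrow> n \<ge> M \<Longrightarrow> dist (X m) (X n) < 1"
      using metric_CauchyD[OF X, of 1] by auto
    have "(\<lambda>v. Rep_l2 (X M) v - f v) \<in> ell2"
      by (rule ell2I_bounded(1), rule fatou[of 1 M M]) (use M in auto)
    from ell2_add[OF Rep_l2[of "X M"] ell2_cmult[OF this, of "-1"]] show ?thesis
      by simp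
  qed
  have "X \<longlonglongrightarrow> Abs_l2 f"
  proof (rule metric_LIMSEQ_I)
    fix e :: real assume "0 < e"
    then obtain M where M: "\<And>m n. m \<ge> M \<Longrightarrow> n \<ge> M \<Longrightarrow> dist (X m) (X n) < e / 2"
      using metric_CauchyD[OF X, of "e / 2"] by auto
    have "dist (X n) (Abs_l2 f) < e" if "n \<ge> M" for n
    proof -
      have "ell2_norm (\<lambda>v. Rep_l2 (X n) v - f v) \<le> sqrt ((e / 2)\<^sup>2)"
        by (rule ell2I_bounded(2), rule fatou[of "e / 2" M n]) (use M \<open>0 < e\<close> that in auto)
      then show ?thesis
        using \<open>0 < e\<close> f_ell2
        by (simp add: dist_norm norm_eq_ell2_norm minus_l2.rep_eq Abs_l2_inverse)
    qed
    then show "\<exists>M. \<forall>n\<ge>M. dist (X n) (Abs_l2 f) < e"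
      by blast
  qed
  then show "convergent X"
    by (auto simp: convergent_def)
qed

section \<open>Operators that are bounded below\<close>

text \<open>If \<open>T'\<close> is bounded below, then Richardson iteration for \<open>T \<circ> T'\<close> is a contraction.\<close>
lemma surj_if_adjoint_bounded_below:
  fixes T T' :: "'h :: {real_inner, complete_space} \<Rightarrow> 'h"
  assumes T: "bounded_linear T" and T': "bounded_linear T'"
    and adj: "\<And>f g. inner (T f) g = inner f (T' g)"
    and \<delta>: "\<delta> > 0" "\<And>f. \<delta> * norm f \<le> norm (T' f)"
  shows "surj T"
proof
  interpret T: bounded_linear T by fact
  interpret T': bounded_linear T' by fact
  obtain K where K: "K > 0" "\<And>f. norm (T f) \<le> norm f * K"
    using T.pos_bounded by blast
  \<comment> \<open>The maximum secures \<open>\<delta> \<le> C\<close>, hence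
    \<open>\<tau> * \<delta>\<^sup>2 \<le> 1\<close>, even on the zero space, where \<open>K\<close>
    may be small.\<close>
  define C where "C = max K \<delta>"
  have C: "C > 0" "\<delta> \<le> C" "\<And>f. norm (T f) \<le> C * norm f"
  proof -
    show "norm (T f) \<le> C * norm f" for f
      using K(2)[of f] mult_left_mono[of K C "norm f"] by (simp add: C_def mult.commute)
  qed (use \<delta> in \<open>auto simp: C_def\<close>)
  define \<tau> where "\<tau> = 1 / C\<^sup>2"
  have contr: "(norm (h - \<tau> *\<^sub>R T (T' h)))\<^sup>2 \<le> (1 - \<tau> * \<delta>\<^sup>2) * (norm h)\<^sup>2" for h
  proof -
    \<comment> \<open>Adjointness turns the cross term into \<open>(norm (T' h))\<^sup>2\<close>;
      with this \<open>\<tau>\<close> the quadratic term eats up at most half of it.\<close>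
    have "(norm (h - \<tau> *\<^sub>R T (T' h)))\<^sup>2 =
        (norm h)\<^sup>2 - 2 * \<tau> * (norm (T' h))\<^sup>2 + \<tau>\<^sup>2 * (norm (T (T' h)))\<^sup>2"
      using adj[of "T' h" h] inner_commute[of h "T (T' h)"] unfolding power2_norm_eq_inner
      by (simp add: inner_diff_left inner_diff_right power2_eq_square algebra_simps)
    also have "\<tau>\<^sup>2 * (norm (T (T' h)))\<^sup>2 \<le> \<tau>\<^sup>2 * (C * norm (T' h))\<^sup>2"
      by (intro mult_left_mono power_mono C) auto
    also have "\<tau>\<^sup>2 * (C * norm (T' h))\<^sup>2 = \<tau> * (norm (T' h))\<^sup>2"
      using C(1) by (simp add: \<tau>_def power_mult_distrib field_simps power2_eq_square)
    finally have "(norm (h - \<tau> *\<^sub>R T (T' h)))\<^sup>2 \<le> (norm h)\<^sup>2 - \<tau> * (norm (T' h))\<^sup>2"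
      by linarith
    also have "\<dots> \<le> (norm h)\<^sup>2 - \<tau> * (\<delta> * norm h)\<^sup>2"
      using \<delta> C(1) by (intro diff_left_mono mult_left_mono power_mono) (auto simp: \<tau>_def)
    finally show ?thesis
      by (simp add: algebra_simps power_mult_distrib)
  qed
  define c where "c = sqrt (1 - \<tau> * \<delta>\<^sup>2)"
  have "\<delta>\<^sup>2 \<le> C\<^sup>2"
    using C \<delta>(1) by (intro power_mono) auto
  then have c: "0 \<le> 1 - \<tau> * \<delta>\<^sup>2" "0 \<le> c" "c < 1"
    using C(1) \<delta>(1) by (auto simp: c_def \<tau>_def)
  have contr': "norm (h - \<tau> *\<^sub>R T (T' h)) \<le> c * norm h" for h
    using contr[of h] c(1) unfolding c_def
    by (metis norm_ge_zero real_sqrt_le_mono real_sqrt_mult real_sqrt_unique)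
  show "UNIV \<subseteq> range T"
  proof
    fix g
    have "\<exists>!f. f + \<tau> *\<^sub>R (g - T (T' f)) = f"
    proof (rule banach_fix_type[OF c(2,3)], intro allI)
      fix x y
      have "(x + \<tau> *\<^sub>R (g - T (T' x))) - (y + \<tau> *\<^sub>R (g - T (T' y)))
          = (x - y) - \<tau> *\<^sub>R T (T' (x - y))"
        by (simp add: T.diff T'.diff algebra_simps)
      then show "dist (x + \<tau> *\<^sub>R (g - T (T' x))) (y + \<tau> *\<^sub>R (g - T (T' y))) \<le> c * dist x y"
        using contr'[of "x - y"] by (simp only: dist_norm)
    qed
    then obtain f where "f + \<tau> *\<^sub>R (g - T (T' f)) = f"
      by blast
    then have "g = T (T' f)"
      using C(1) by (simp add: \<tau>_def)
    then show "g \<in> range T"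
      by blast
  qed
qed simp

text \<open>Both bounds come from one identity: \<open>(norm (L f))\<^sup>2\<close> is
  \<open>(3 * a - 3/4)\<^sup>2 * (norm f)\<^sup>2\<close> plus
  \<open>a * b * (norm U)\<^sup>2\<close>, and the last term lies between 0 and
  \<open>9 * a * b * (norm f)\<^sup>2\<close>.\<close>

lemma two_projections_bounds:
  fixes P Q L :: "'h :: real_inner \<Rightarrow> 'h" and a b :: real
  assumes P: "linear P" "\<And>f g. inner (P f) g = inner f (P g)" "\<And>f. P (P f) = 3 *\<^sub>R P f"
    and Q: "linear Q" "\<And>f g. inner (Q f) g = inner f (Q g)" "\<And>f. Q (Q f) = 3 *\<^sub>R Q f"
    and ab: "a \<ge> 0" "b \<ge> 0" "a + b = 1/2"
    and L: "\<And>f. L f = (3/4) *\<^sub>R f - a *\<^sub>R P f - b *\<^sub>R Q f"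
  shows "\<bar>3 * a - 3/4\<bar> * norm f \<le> norm (L f)" "norm (L f) \<le> 3/4 * norm f"
proof -
  \<comment> \<open>In terms of the projections p and q these are 3 (1 - p - q) f and 3 (p - q) f;
    their squared norms add up to 9 times that of \<open>f\<close>.\<close>
  define U where "U = 3 *\<^sub>R f - P f - Q f"
  define W where "W = P f - Q f"
  have [simp]: "inner (P f) f = inner f (P f)" "inner (Q f) f = inner f (Q f)"
    "inner (Q f) (P f) = inner (P f) (Q f)"
    by (simp_all add: inner_commute)
  have PQ: "inner (P f) (P f) = 3 * inner f (P f)" "inner (Q f) (Q f) = 3 * inner f (Q f)"
    using P(2)[of f "P f"] Q(2)[of f "Q f"] by (simp_all add: P(3) Q(3))
  have b: "b = 1/2 - a"
    using ab(3) by simp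
  have 1: "(norm (L f))\<^sup>2 = (3 * a - 3/4)\<^sup>2 * (norm f)\<^sup>2 + a * b * (norm U)\<^sup>2"
    unfolding power2_norm_eq_inner L U_def
    by (simp add: inner_diff_left inner_diff_right PQ b algebra_simps power2_eq_square)
  have 2: "(norm U)\<^sup>2 = 9 * (norm f)\<^sup>2 - (norm W)\<^sup>2"
    unfolding power2_norm_eq_inner W_def U_def
    by (simp add: inner_diff_left inner_diff_right PQ algebra_simps)
  have "(\<bar>3 * a - 3/4\<bar> * norm f)\<^sup>2 \<le> (norm (L f))\<^sup>2"
    using 1 ab by (simp add: power_mult_distrib)
  then show "\<bar>3 * a - 3/4\<bar> * norm f \<le> norm (L f)"
    by (rule power2_le_imp_le) simp
  have "a * b * (norm U)\<^sup>2 \<le> a * b * (9 * (norm f)\<^sup>2)"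
    using 2 ab by (intro mult_left_mono) auto
  also have "(3 * a - 3/4)\<^sup>2 * (norm f)\<^sup>2 + \<dots> = (3/4 * norm f)\<^sup>2"
    by (simp add: b power2_eq_square algebra_simps)
  finally have "(norm (L f))\<^sup>2 \<le> (3/4 * norm f)\<^sup>2"
    using 1 by linarith
  then show "norm (L f) \<le> 3/4 * norm f"
    by (rule power2_le_imp_le) simp
qed

text \<open>\<open>J\<close> stands for multiplication by the imaginary unit. It commutes with the
  symmetric \<open>S\<close>, so the cross term \<open>inner (S f) (J f)\<close> equals its own
  negative. This is what excludes nonreal spectrum.\<close>

lemma shifted_symmetric_norm:
  fixes S J :: "'h :: real_inner \<Rightarrow> 'h"
  assumes S: "\<And>f g. inner (S f) g = inner f (S g)"
    and J: "\<And>f g. inner (J f) g = - inner f (J g)" "\<And>f. J (J f) = - f" "\<And>f. S (J f) = J (S f)"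
  shows "(norm (S f + y *\<^sub>R J f))\<^sup>2 = (norm (S f))\<^sup>2 + y\<^sup>2 * (norm f)\<^sup>2"
proof -
  have "inner (J f) (J f) = inner f f"
    using J(1)[of f "J f"] by (simp add: J(2))
  moreover have "inner (S f) (J f) = - inner (S f) (J f)"
    by (metis J(1,3) S inner_commute)
  ultimately show ?thesis
    unfolding power2_norm_eq_inner
    by (simp add: inner_add_left inner_add_right inner_commute power2_eq_square)
qed

section \<open>Laplacians built from two rotations of order three\<close>

text \<open>This skew map carries the complex structure on the real space: subtracting the number x
  + i y from an operator means subtracting x times the identity and y times
  \<open>imul\<close>.\<close>

lift_definition imul :: "'a l2 \<Rightarrow> 'a l2" is "\<lambda>f v. \<i> * f v"
  by (rule ell2_cmult)

lemma imul_imul: "imul (imul f) = - f"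
  by transfer (simp add: fun_eq_iff flip: mult.assoc)

lemma inner_imul_left: "inner (imul f) g = - inner f (imul g)"
  by transfer (simp add: infsum_uminus[symmetric] algebra_simps)

lemma linear_imul: "linear imul"
  by (rule linearI; transfer) (auto simp: algebra_simps)

lemma norm_imul: "norm (imul f) = norm f"
  using inner_imul_left[of f "imul f"] by (simp add: norm_eq_sqrt_inner imul_imul)

text \<open>If the third power of \<open>p\<close> is the identity, this is three times the
  orthogonal projection onto the functions constant on the orbits of \<open>p\<close>;
  \<open>Rep_orbit_sum\<close> justifies \<open>Abs_l2\<close> in that case.\<close>

definition orbit_sum :: "('a \<Rightarrow> 'a) \<Rightarrow> 'a l2 \<Rightarrow> 'a l2" where
  "orbit_sum p f = Abs_l2 (\<lambda>v. Rep_l2 f v + Rep_l2 f (p v) + Rep_l2 f (p (p v)))"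

context
  fixes p :: "'a \<Rightarrow> 'a"
  assumes cubed: "\<And>v. p (p (p v)) = v"
begin

lemma bij_of_cubed: "bij p"
  by (rule o_bij[of "p \<circ> p"]) (auto simp: cubed fun_eq_iff)

lemma ell2_orbit:
  assumes "f \<in> ell2"
  shows "(\<lambda>v. f (p v)) \<in> ell2" "(\<lambda>v. f (p (p v))) \<in> ell2"
  using ell2_comp[OF assms bij_of_cubed] ell2_comp[OF _ bij_of_cubed, of "\<lambda>v. f (p v)"]
  by auto

lemma Rep_orbit_sum: "Rep_l2 (orbit_sum p f) v = Rep_l2 f v + Rep_l2 f (p v) + Rep_l2 f (p (p v))"
  unfolding orbit_sum_def
  by (subst Abs_l2_inverse) (auto intro!: ell2_add ell2_orbit Rep_l2)

lemma linear_orbit_sum: "linear (orbit_sum p)"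
  by (rule linearI)
    (auto simp: Rep_l2_inject[symmetric] fun_eq_iff Rep_orbit_sum plus_l2.rep_eq scaleR_l2.rep_eq
      algebra_simps)

lemma orbit_sum_orbit_sum: "orbit_sum p (orbit_sum p f) = 3 *\<^sub>R orbit_sum p f"
  by (auto simp: Rep_l2_inject[symmetric] fun_eq_iff Rep_orbit_sum scaleR_l2.rep_eq cubed)

lemma orbit_sum_imul: "orbit_sum p (imul f) = imul (orbit_sum p f)"
  by (auto simp: Rep_l2_inject[symmetric] fun_eq_iff Rep_orbit_sum imul.rep_eq algebra_simps)

text \<open>Reindexing the sum by \<open>p\<close> moves the rotation to the other factor. As
  \<open>p\<close> and its square are mutually inverse, the two rotated terms swap.\<close>

lemma inner_orbit_sum: "inner (orbit_sum p f) g = inner f (orbit_sum p g)"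
proof -
  define F G where "F = Rep_l2 f" and "G = Rep_l2 g"
  have mem [simp]: "F \<in> ell2" "G \<in> ell2"
    by (auto simp: F_def G_def Rep_l2)
  note mem [simp] = ell2_orbit[OF mem(1)] ell2_orbit[OF mem(2)]
  define B where "B f g = (\<Sum>\<^sub>\<infinity>v. Re (f v * cnj (g v)))" for f g :: "'a \<Rightarrow> complex"
  have B_add: "B (\<lambda>v. f v + g v) h = B f h + B g h" "B h (\<lambda>v. f v + g v) = B h f + B h g"
    if "f \<in> ell2" "g \<in> ell2" "h \<in> ell2" for f g h
    using infsum_add[OF ell2_mult_summable[of f h] ell2_mult_summable[of g h]]
      infsum_add[OF ell2_mult_summable[of h f] ell2_mult_summable[of h g]] that
    by (simp_all add: B_def ring_distribs del: times_complex.simps)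
  have "inner (orbit_sum p f) g = B (\<lambda>v. F v + F (p v) + F (p (p v))) G"
    unfolding inner_l2.rep_eq Rep_orbit_sum F_def G_def B_def ..
  also have "\<dots> = B F G + B (\<lambda>v. F (p v)) G + B (\<lambda>v. F (p (p v))) G"
    by (simp add: B_add ell2_add)
  also have "B (\<lambda>v. F (p v)) G = B F (\<lambda>v. G (p (p v)))"
    using infsum_reindex_bij_betw[OF bij_of_cubed, of "\<lambda>v. Re (F v * cnj (G (p (p v))))"]
    by (simp add: B_def cubed)
  also have "B (\<lambda>v. F (p (p v))) G = B F (\<lambda>v. G (p v))"
    using infsum_reindex_bij_betw[OF bij_of_cubed, of "\<lambda>v. Re (F (p (p v)) * cnj (G v))"]
    by (simp add: B_def cubed)
  also have "B F G + B F (\<lambda>v. G (p (p v))) + B F (\<lambda>v. G (p v))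
      = B F (\<lambda>v. G v + G (p v) + G (p (p v)))"
    by (simp add: B_add ell2_add)
  also have "\<dots> = inner f (orbit_sum p g)"
    unfolding inner_l2.rep_eq Rep_orbit_sum F_def G_def B_def ..
  finally show ?thesis .
qed

lemma norm_orbit_sum_le: "norm (orbit_sum p f) \<le> 3 * norm f"
proof -
  have "norm (orbit_sum p f) * norm (orbit_sum p f) = 3 * inner f (orbit_sum p f)"
    using inner_orbit_sum[of f "orbit_sum p f"]
    by (simp add: orbit_sum_orbit_sum flip: power2_norm_eq_inner power2_eq_square)
  also have "\<dots> \<le> (3 * norm f) * norm (orbit_sum p f)"
    using norm_cauchy_schwarz[of f "orbit_sum p f"] by simp
  finally show ?thesis
    by (cases "norm (orbit_sum p f) = 0") (auto simp: mult_le_cancel_right)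
qed

lemma bounded_linear_orbit_sum: "bounded_linear (orbit_sum p)"
  using norm_orbit_sum_le linear_orbit_sum
  by (intro bounded_linear_intro[of _ 3]) (auto simp: linear_add linear_scale mult.commute)

end

section \<open>The spectrum lies in the two bands\<close>

text \<open>For \<open>z\<close> outside the claimed set, the shifted operator is \<open>R\<close>,
  that is \<open>S\<close> minus \<open>y\<close> times \<open>imul\<close> with \<open>S\<close>
  symmetric, and its adjoint is \<open>R'\<close>. Both are bounded below, so \<open>R\<close> is
  injective with bounded inverse, and surjective thanks to \<open>R'\<close>.\<close>

lemma spectrum_two_rotations_subset:
  fixes p q :: "'a \<Rightarrow> 'a" and a b :: real
  assumes p: "\<And>v. p (p (p v)) = v" and q: "\<And>v. q (q (q v)) = v"
    and ab: "a \<ge> 0" "b \<ge> 0" "a + b = 1/2"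
    and T: "\<And>f v. T f v = f v - of_real a * (f (p v) + f (p (p v)))
                            - of_real b * (f (q v) + f (q (q v)))"
    and z: "z \<in> op_spectrum ell2 ell2_norm T"
  shows "\<exists>t. z = of_real t \<and> \<bar>3 * a - 3/4\<bar> \<le> \<bar>t - 3/4\<bar> \<and> \<bar>t - 3/4\<bar> \<le> 3/4"
proof (rule ccontr)
  assume not: "\<not> ?thesis"
  define d where "d = \<bar>3 * a - 3/4\<bar>"
  define x y where "x = Re z" and "y = Im z"
  have z_eq: "z = Complex x y"
    by (simp add: x_def y_def)
  have xy: "y \<noteq> 0 \<or> \<bar>x - 3/4\<bar> < d \<or> \<bar>x - 3/4\<bar> > 3/4"
    using not by (auto simp: z_eq d_def complex_eq_iff intro!: exI[of _ x])
  define P Q where "P = orbit_sum p" and "Q = orbit_sum q"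
  define L where "L f = (3/4) *\<^sub>R f - a *\<^sub>R P f - b *\<^sub>R Q f" for f
  define S where "S f = L f - (x - 3/4) *\<^sub>R f" for f
  note P = linear_orbit_sum[OF p] inner_orbit_sum[OF p] orbit_sum_orbit_sum[OF p]
  note Q = linear_orbit_sum[OF q] inner_orbit_sum[OF q] orbit_sum_orbit_sum[OF q]
  note L_bounds = two_projections_bounds[OF P[folded P_def] Q[folded Q_def] ab L_def, folded d_def]
  have S_sym: "inner (S f) g = inner f (S g)" for f g
    by (simp add: S_def L_def P_def Q_def inner_diff_left inner_diff_right P(2) Q(2))
  have S_imul: "S (imul f) = imul (S f)" for f
    by (simp add: S_def L_def P_def Q_def orbit_sum_imul p q linear_diff[OF linear_imul]
        linear_scale[OF linear_imul])
  have norm_eq: "(norm (S f + c *\<^sub>R imul f))\<^sup>2 = (norm (S f))\<^sup>2 + c\<^sup>2 * (norm f)\<^sup>2" for f c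
    by (rule shifted_symmetric_norm[OF S_sym inner_imul_left imul_imul S_imul])
  have "\<exists>\<delta>>0. \<forall>f c. \<bar>c\<bar> = \<bar>y\<bar> \<longrightarrow> \<delta> * norm f \<le> norm (S f + c *\<^sub>R imul f)"
  proof (cases "y = 0")
    case False
    have "\<bar>y\<bar> * norm f \<le> norm (S f + c *\<^sub>R imul f)" if "\<bar>c\<bar> = \<bar>y\<bar>" for f c
    proof (rule power2_le_imp_le)
      have "c\<^sup>2 = y\<^sup>2"
        using that by (metis power2_abs)
      then show "(\<bar>y\<bar> * norm f)\<^sup>2 \<le> (norm (S f + c *\<^sub>R imul f))\<^sup>2"
        by (simp add: norm_eq power_mult_distrib)
    qed simp
    with False show ?thesis
      by (intro exI[of _ "\<bar>y\<bar>"]) auto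
  next
    case True
    \<comment> \<open>\<open>S\<close> is \<open>L\<close> shifted by \<open>x - 3/4\<close>. The
      two entries are the reverse triangle inequalities for the lower and the upper bound on
      \<open>L\<close>; outside the bands at least one is positive.\<close>
    define \<delta> where "\<delta> = max (d - \<bar>x - 3/4\<bar>) (\<bar>x - 3/4\<bar> - 3/4)"
    have "\<delta> * norm f \<le> norm (S f)" for f
    proof -
      have "(d - \<bar>x - 3/4\<bar>) * norm f \<le> norm (S f)"
        using norm_triangle_ineq2[of "L f" "(x - 3/4) *\<^sub>R f"] L_bounds(1)[of f]
        by (simp add: S_def left_diff_distrib)
      moreover have "(\<bar>x - 3/4\<bar> - 3/4) * norm f \<le> norm (S f)"
        using norm_triangle_ineq2[of "(x - 3/4) *\<^sub>R f" "L f"] L_bounds(2)[of f]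
        by (simp add: S_def left_diff_distrib norm_minus_commute)
      ultimately show ?thesis
        by (auto simp: \<delta>_def max_def)
    qed
    moreover have "\<delta> > 0"
      using xy True unfolding \<delta>_def less_max_iff_disj by auto
    ultimately show ?thesis
      using True by auto
  qed
  then obtain \<delta> where \<delta>: "\<delta> > 0"
    "\<And>f c. \<bar>c\<bar> = \<bar>y\<bar> \<Longrightarrow> \<delta> * norm f \<le> norm (S f + c *\<^sub>R imul f)"
    by blast
  define R where "R f = S f + (- y) *\<^sub>R imul f" for f
  define R' where "R' f = S f + y *\<^sub>R imul f" for f
  have bl_imul: "bounded_linear imul"
    by (rule bounded_linear_intro[of _ 1]) (auto simp: linear_add[OF linear_imul]
        linear_scale[OF linear_imul] norm_imul)
  have "bounded_linear (\<lambda>f. S f + c *\<^sub>R imul f)" for c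
    unfolding S_def L_def P_def Q_def
    by (intro bounded_linear_add bounded_linear_sub bounded_linear_const_scaleR bounded_linear_ident
        bl_imul bounded_linear_orbit_sum p q)
  then have bl: "bounded_linear R" "bounded_linear R'"
    by (auto simp: R_def[abs_def] R'_def[abs_def] simp del: scaleR_minus_left)
  have adj: "inner (R f) g = inner f (R' g)" for f g
    by (simp add: R_def R'_def inner_diff_left inner_add_right S_sym inner_imul_left)
  have bound': "\<delta> * norm f \<le> norm (R' f)" for f
    using \<delta>(2)[of y f] by (simp add: R'_def)
  have surj: "surj R"
    by (rule surj_if_adjoint_bounded_below[OF bl adj \<delta>(1) bound'])
  have R_bound: "\<delta> * norm f \<le> norm (R f)" for f
    unfolding R_def by (rule \<delta>(2)) simp
  have inj: "inj R"
  proof (rule injI)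
    fix f g assume "R f = R g"
    then have "R (f - g) = 0"
      using bl(1) by (simp add: linear_diff bounded_linear.linear)
    then show "f = g"
      using R_bound[of "f - g"] \<delta>(1) by (simp add: mult_le_0_iff)
  qed
  have b: "b = 1/2 - a"
    using ab(3) by simp
  have Rep_R: "Rep_l2 (R f) = (\<lambda>v. T (Rep_l2 f) v - z * Rep_l2 f v)" for f
    by (simp add: fun_eq_iff R_def S_def L_def P_def Q_def Rep_orbit_sum p q minus_l2.rep_eq
        plus_l2.rep_eq scaleR_l2.rep_eq uminus_l2.rep_eq imul.rep_eq T z_eq Complex_eq b algebra_simps)
  have *: "(\<lambda>v. T f v - z * f v) = Rep_l2 (R (Abs_l2 f))" if "f \<in> ell2" for f
    using that by (simp add: Rep_R Abs_l2_inverse)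
  have "bij_betw (\<lambda>f v. T f v - z * f v) ell2 ell2"
  proof -
    have "bij_betw (Rep_l2 \<circ> (R \<circ> Abs_l2)) ell2 ell2"
    proof (intro bij_betw_trans)
      show "bij_betw Abs_l2 ell2 UNIV"
        by (rule bij_betwI[of _ _ _ Rep_l2]) (auto simp: Rep_l2 Abs_l2_inverse Rep_l2_inverse)
      show "bij_betw R UNIV UNIV"
        using inj surj by (simp add: bij_betw_def)
      show "bij_betw Rep_l2 UNIV ell2"
        by (rule bij_betwI[of _ _ _ Abs_l2]) (auto simp: Rep_l2 Abs_l2_inverse Rep_l2_inverse)
    qed
    then show ?thesis
      by (rule bij_betw_cong[THEN iffD1, rotated]) (simp add: *)
  qed
  moreover have "ell2_norm f \<le> (1 / \<delta>) * ell2_norm (\<lambda>v. T f v - z * f v)" if "f \<in> ell2" for f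
    using R_bound[of "Abs_l2 f"] \<delta>(1) that
    by (simp add: *[OF that] norm_eq_ell2_norm Abs_l2_inverse field_simps)
  ultimately show False
    using z unfolding op_spectrum_def by blast
qed

section \<open>Triangle rotations of the Kagome lattice\<close>

text \<open>\<open>rotA\<close> cycles the corners of the triangle with edges 2, 4, 6 through a
  vertex, \<open>rotB\<close> those of the triangle with edges 1, 3, 5. The four neighbours are thus
  the nontrivial rotates.\<close>

fun rotA :: "vertex \<Rightarrow> vertex" where
  "rotA (V1, m, n) = (V2, m + 1, n)"
| "rotA (V2, m, n) = (V3, m, n)"
| "rotA (V3, m, n) = (V1, m - 1, n)"

fun rotB :: "vertex \<Rightarrow> vertex" where
  "rotB (V1, m, n) = (V2, m, n)"
| "rotB (V2, m, n) = (V3, m, n + 1)"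
| "rotB (V3, m, n) = (V1, m, n - 1)"

lemma vertex_cases:
  obtains m n where "v = (V1, m, n)" | m n where "v = (V2, m, n)" | m n where "v = (V3, m, n)"
  by (cases v; cases "fst v") auto

lemma rotA_cubed [simp]: "rotA (rotA (rotA v)) = v"
  by (cases v rule: vertex_cases) auto

lemma rotB_cubed [simp]: "rotB (rotB (rotB v)) = v"
  by (cases v rule: vertex_cases) auto

lemma eq_translate_iff: "v = translate \<beta> a \<longleftrightarrow> fst v = fst a \<and> \<beta> = snd v - snd a"
  by (auto simp: translate_def prod_eq_iff)

lemma kagome_edge_iff:
  "kagome_edge k v w \<longleftrightarrow> (\<exists>a b. (k, a, b) \<in> base_edges \<and>
     (fst v = fst a \<and> fst w = fst b \<and> snd v - snd a = snd w - snd b \<or>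
      fst w = fst a \<and> fst v = fst b \<and> snd w - snd a = snd v - snd b))"
  unfolding kagome_edge_def doubleton_eq_iff eq_translate_iff
  by (intro iff_exI) (auto simp del: split_paired_Ex split_paired_All)

lemma kagome_edge_simps:
  "kagome_edge k (V1, m, n) (j, p, q) \<longleftrightarrow>
     k = 1 \<and> j = V3 \<and> p = m \<and> q = n + 1 \<or> k = 3 \<and> j = V2 \<and> p = m \<and> q = n \<or>
     k = 4 \<and> j = V3 \<and> p = m + 1 \<and> q = n \<or> k = 6 \<and> j = V2 \<and> p = m + 1 \<and> q = n"
  "kagome_edge k (V2, m, n) (j, p, q) \<longleftrightarrow>
     k = 2 \<and> j = V3 \<and> p = m \<and> q = n \<or> k = 3 \<and> j = V1 \<and> p = m \<and> q = n \<or>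
     k = 5 \<and> j = V3 \<and> p = m \<and> q = n + 1 \<or> k = 6 \<and> j = V1 \<and> p = m - 1 \<and> q = n"
  "kagome_edge k (V3, m, n) (j, p, q) \<longleftrightarrow>
     k = 1 \<and> j = V1 \<and> p = m \<and> q = n - 1 \<or> k = 2 \<and> j = V2 \<and> p = m \<and> q = n \<or>
     k = 4 \<and> j = V1 \<and> p = m - 1 \<and> q = n \<or> k = 5 \<and> j = V2 \<and> p = m \<and> q = n - 1"
  unfolding kagome_edge_iff base_edges_def
  by (cases j; simp del: One_nat_def add: conj_disj_distribL conj_disj_distribR ex_disj_distrib;
      fastforce)+

lemma kagome_neighbours:
  "{w. kagome_adj v w} = {rotA v, rotA (rotA v), rotB v, rotB (rotB v)}"
proof -
  have "kagome_adj v (j, p, q) \<longleftrightarrow> (j, p, q) \<in> {rotA v, rotA (rotA v), rotB v, rotB (rotB v)}" for j p q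
    unfolding kagome_adj_def
    by (cases v rule: vertex_cases; cases j) (auto simp: kagome_edge_simps simp del: One_nat_def)
  then show ?thesis
    by auto
qed

lemma laplacian_eq_rot:
  assumes "\<gamma> 2 = \<alpha>" "\<gamma> 4 = \<alpha>" "\<gamma> 6 = \<alpha>" "\<gamma> 1 = \<beta>" "\<gamma> 3 = \<beta>" "\<gamma> 5 = \<beta>"
  shows "laplacian \<mu> \<gamma> f v =
    f v - of_real (\<alpha> / \<mu>) * (f (rotA v) + f (rotA (rotA v)))
        - of_real (\<beta> / \<mu>) * (f (rotB v) + f (rotB (rotB v)))"
proof -
  \<comment> \<open>Every ordered pair of neighbours carries exactly one edge index, so
    \<open>edge_weight\<close> collapses to \<open>\<alpha>\<close> along \<open>rotA\<close> and to
    \<open>\<beta>\<close> along \<open>rotB\<close>.\<close>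
  have K: "{k. kagome_edge k (V1,m,n) (V2,m+1,n)} = {6}"
      "{k. kagome_edge k (V1,m,n) (V3,m+1,n)} = {4}"
      "{k. kagome_edge k (V1,m,n) (V2,m,n)} = {3}"
      "{k. kagome_edge k (V1,m,n) (V3,m,n+1)} = {1}"
      "{k. kagome_edge k (V2,m,n) (V3,m,n)} = {2}"
      "{k. kagome_edge k (V2,m,n) (V1,m-1,n)} = {6}"
      "{k. kagome_edge k (V2,m,n) (V3,m,n+1)} = {5}"
      "{k. kagome_edge k (V2,m,n) (V1,m,n)} = {3}"
      "{k. kagome_edge k (V3,m,n) (V1,m-1,n)} = {4}"
      "{k. kagome_edge k (V3,m,n) (V2,m,n)} = {2}"
      "{k. kagome_edge k (V3,m,n) (V1,m,n-1)} = {1}"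
      "{k. kagome_edge k (V3,m,n) (V2,m,n-1)} = {5}" for m n
    by (auto simp: kagome_edge_simps)
  show ?thesis
    unfolding laplacian_def kagome_neighbours edge_weight_def
    by (cases v rule: vertex_cases)
      (simp_all add: K assms algebra_simps divide_inverse del: One_nat_def)
qed

section \<open>Weyl sequences\<close>

definition rot_laplacian :: "real \<Rightarrow> real \<Rightarrow> (vertex \<Rightarrow> complex) \<Rightarrow> vertex \<Rightarrow> complex" where
  "rot_laplacian a b f v = f v - of_real a * (f (rotA v) + f (rotA (rotA v)))
                               - of_real b * (f (rotB v) + f (rotB (rotB v)))"

lemma site_UNIV: "(UNIV :: site set) = {V1, V2, V3}"
  using site.nchotomy by auto

lemma finite_site: "finite (UNIV :: site set)"
  by (simp add: site_UNIV)

text \<open>Exponential damping in the l1 length of the cell index. For 0 < r < 1 it is square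
  summable, yet a step to an adjacent cell changes it only by a factor \<open>r\<close> or
  \<open>1 / r\<close>, which tends to 1 with \<open>r\<close>.\<close>

definition decay :: "real \<Rightarrow> int \<times> int \<Rightarrow> real" where
  "decay r n = r ^ nat \<bar>fst n\<bar> * r ^ nat \<bar>snd n\<bar>"

lemma summable_on_power_nat_abs:
  fixes r :: real
  assumes "0 < r" "r < 1"
  shows "(\<lambda>m. r ^ nat \<bar>m\<bar>) summable_on UNIV"
proof -
  have geo: "(\<lambda>n. r ^ n) summable_on UNIV"
    using assms by (intro norm_summable_imp_summable_on) (simp add: norm_power summable_geometric)
  have "(\<lambda>m. r ^ nat \<bar>m\<bar>) summable_on range int"
    by (subst summable_on_reindex) (use geo in \<open>auto simp: o_def\<close>)
  moreover have "(\<lambda>m. r ^ nat \<bar>m\<bar>) summable_on range (\<lambda>n. - int n)"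
    by (subst summable_on_reindex) (use geo in \<open>auto simp: o_def inj_on_def\<close>)
  moreover have "range int \<union> range (\<lambda>n. - int n) = UNIV"
    by (auto simp: image_iff) (metis int_cases2)
  ultimately show ?thesis
    using summable_on_union by metis
qed

lemma summable_on_decay_sq:
  assumes "0 < r" "r < 1"
  shows "(\<lambda>n. (decay r n)\<^sup>2) summable_on UNIV"
proof -
  have "0 < r\<^sup>2" "r\<^sup>2 < 1"
    using assms mult_strict_mono[of r 1 r 1] by (simp_all add: power2_eq_square)
  note s = summable_on_power_nat_abs[OF this]
  have "(\<lambda>(m, n). (r\<^sup>2) ^ nat \<bar>m\<bar> * (r\<^sup>2) ^ nat \<bar>n\<bar>) summable_on UNIV \<times> UNIV"
  proof (rule summable_on_SigmaI)
    fix m :: int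
    show "((\<lambda>n. case (m, n) of (m, n) \<Rightarrow> (r\<^sup>2) ^ nat \<bar>m\<bar> * (r\<^sup>2) ^ nat \<bar>n\<bar>) has_sum
        (r\<^sup>2) ^ nat \<bar>m\<bar> * (\<Sum>\<^sub>\<infinity>n. (r\<^sup>2) ^ nat \<bar>n\<bar>)) UNIV"
      using has_sum_cmult_right[OF has_sum_infsum[OF s]] by simp
    show "(\<lambda>m. (r\<^sup>2) ^ nat \<bar>m\<bar> * (\<Sum>\<^sub>\<infinity>n. (r\<^sup>2) ^ nat \<bar>n\<bar>)) summable_on UNIV"
      by (rule summable_on_cmult_left[OF s])
  qed auto
  then show ?thesis
    by (simp add: decay_def case_prod_unfold power_mult_distrib mult.commute flip: power_mult)
qed

lemma decay_pos: "0 < r \<Longrightarrow> 0 < decay r n"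
  by (simp add: decay_def)

text \<open>The ratio of the two powers is 1, \<open>r\<close> or \<open>1 / r\<close>, and 1 - r is
  at most \<open>1 / r - 1\<close>.\<close>

lemma power_neighbour_diff:
  fixes r :: real
  assumes r: "0 < r" "r < 1" and "k \<le> Suc l" "l \<le> Suc k"
  shows "\<bar>r ^ k - r ^ l\<bar> \<le> (1 / r - 1) * r ^ l"
proof -
  have inv: "1 / r - 1 = (1 - r) / r"
    using r by (simp add: diff_divide_distrib)
  consider "k = l" | "k = Suc l" | "l = Suc k"
    using assms by linarith
  then show ?thesis
  proof cases
    case 1
    then show ?thesis
      using r by (simp add: inv)
  next
    case 2
    have "1 - r \<le> (1 - r) / r"
      using r by (simp add: le_divide_eq mult_left_le)
    then have "(1 - r) * r ^ l \<le> (1 / r - 1) * r ^ l"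
      using r unfolding inv by (intro mult_right_mono) auto
    moreover have "r ^ k - r ^ l = - ((1 - r) * r ^ l)"
      by (simp add: 2 algebra_simps)
    ultimately show ?thesis
      using r by (simp add: abs_mult)
  next
    case 3
    have "r ^ k - r ^ l = (1 / r - 1) * r ^ l"
      using r by (simp add: 3 inv field_simps)
    moreover have "(1 / r - 1) * r ^ l \<ge> 0"
      using r by (simp add: inv)
    ultimately show ?thesis
      by simp
  qed
qed

lemma decay_neighbour_diff:
  assumes r: "0 < r" "r < 1" and "\<bar>m' - m\<bar> + \<bar>n' - n\<bar> \<le> 1"
  shows "\<bar>decay r (m', n') - decay r (m, n)\<bar> \<le> (1 / r - 1) * decay r (m, n)"
proof -
  have "\<bar>r ^ (nat \<bar>m'\<bar> + nat \<bar>n'\<bar>) - r ^ (nat \<bar>m\<bar> + nat \<bar>n\<bar>)\<bar>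
      \<le> (1 / r - 1) * r ^ (nat \<bar>m\<bar> + nat \<bar>n\<bar>)"
    using assms by (intro power_neighbour_diff) linarith+
  then show ?thesis
    by (simp add: decay_def power_add)
qed

lemma decay_rot_diff:
  assumes r: "0 < r" "r < 1" and "w \<in> {rotA v, rotA (rotA v), rotB v, rotB (rotB v)}"
  shows "\<bar>decay r (snd w) - decay r (snd v)\<bar> \<le> (1 / r - 1) * decay r (snd v)"
proof -
  have "0 \<le> (1 / r - 1) * decay r n" for n
    using r decay_pos[OF r(1), of n] by simp
  then show ?thesis
    using assms(3) by (cases v rule: vertex_cases) (auto intro!: decay_neighbour_diff r)
qed

text \<open>The factor 3 counts the sites of a cell. This bound and
  \<open>ell2_norm_lower_decay\<close> involve the same series, which therefore cancels when a
  damped wave is compared with its residual.\<close>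

lemma ell2_decay_bound:
  fixes g :: "vertex \<Rightarrow> complex"
  assumes r: "0 < r" "r < 1" and g: "\<And>v. cmod (g v) \<le> D * decay r (snd v)"
  shows "g \<in> ell2" "(ell2_norm g)\<^sup>2 \<le> 3 * D\<^sup>2 * (\<Sum>\<^sub>\<infinity>n. (decay r n)\<^sup>2)"
proof -
  have fin: "(\<Sum>v\<in>F. (cmod (g v))\<^sup>2) \<le> 3 * D\<^sup>2 * (\<Sum>\<^sub>\<infinity>n. (decay r n)\<^sup>2)" if F: "finite F" for F
  proof -
    have "(\<Sum>v\<in>F. (cmod (g v))\<^sup>2) \<le> (\<Sum>v\<in>F. (D * decay r (snd v))\<^sup>2)"
      by (intro sum_mono power_mono g) auto
    also have "\<dots> \<le> (\<Sum>v\<in>(UNIV :: site set) \<times> snd ` F. (D * decay r (snd v))\<^sup>2)"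
      by (rule sum_mono2) (use F in \<open>force simp: finite_site\<close>)+
    also have "\<dots> = (\<Sum>j\<in>(UNIV :: site set). \<Sum>n\<in>snd ` F. (D * decay r n)\<^sup>2)"
      by (subst sum.cartesian_product) (simp add: case_prod_unfold)
    also have "\<dots> = 3 * D\<^sup>2 * (\<Sum>n\<in>snd ` F. (decay r n)\<^sup>2)"
      by (simp add: site_UNIV power_mult_distrib sum_distrib_left mult.assoc)
    also have "\<dots> \<le> 3 * D\<^sup>2 * (\<Sum>\<^sub>\<infinity>n. (decay r n)\<^sup>2)"
      using F by (intro mult_left_mono finite_sum_le_infsum summable_on_decay_sq r) auto
    finally show ?thesis .
  qed
  show "g \<in> ell2"
    using fin by (rule ell2I_bounded(1))
  have "(ell2_norm g)\<^sup>2 \<le> (sqrt (3 * D\<^sup>2 * (\<Sum>\<^sub>\<infinity>n. (decay r n)\<^sup>2)))\<^sup>2"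
    using ell2I_bounded(2)[OF fin]
    by (intro power_mono) (auto simp: ell2_norm_def infsum_nonneg)
  then show "(ell2_norm g)\<^sup>2 \<le> 3 * D\<^sup>2 * (\<Sum>\<^sub>\<infinity>n. (decay r n)\<^sup>2)"
    by (simp add: infsum_nonneg)
qed

lemma ell2_norm_lower_decay:
  fixes g :: "vertex \<Rightarrow> complex"
  assumes r: "0 < r" "r < 1" and g: "g \<in> ell2" and "c \<ge> 0"
    and *: "\<And>n. c * decay r n \<le> cmod (g (j, n))"
  shows "c\<^sup>2 * (\<Sum>\<^sub>\<infinity>n. (decay r n)\<^sup>2) \<le> (ell2_norm g)\<^sup>2"
proof -
  have s: "(\<lambda>v. (cmod (g v))\<^sup>2) summable_on range (Pair j)"
    by (rule summable_on_subset_banach[of _ UNIV]) (use g in \<open>auto simp: ell2_def\<close>)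
  then have s': "(\<lambda>n. (cmod (g (j, n)))\<^sup>2) summable_on UNIV"
    by (subst (asm) summable_on_reindex) (auto simp: o_def inj_on_def)
  have "c\<^sup>2 * (\<Sum>\<^sub>\<infinity>n. (decay r n)\<^sup>2) = (\<Sum>\<^sub>\<infinity>n. (c * decay r n)\<^sup>2)"
    by (simp add: power_mult_distrib infsum_cmult_right')
  also have "\<dots> \<le> (\<Sum>\<^sub>\<infinity>n. (cmod (g (j, n)))\<^sup>2)"
  proof (rule infsum_mono[OF _ s'])
    show "(\<lambda>n. (c * decay r n)\<^sup>2) summable_on UNIV"
      unfolding power_mult_distrib by (intro summable_on_cmult_right summable_on_decay_sq r)
    show "(c * decay r n)\<^sup>2 \<le> (cmod (g (j, n)))\<^sup>2" for n
      using decay_pos[OF r(1), of n] \<open>c \<ge> 0\<close> by (intro power_mono *) auto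
  qed
  also have "\<dots> = (\<Sum>\<^sub>\<infinity>v\<in>range (Pair j). (cmod (g v))\<^sup>2)"
    by (subst infsum_reindex) (auto simp: o_def inj_on_def)
  also have "\<dots> \<le> (\<Sum>\<^sub>\<infinity>v. (cmod (g v))\<^sup>2)"
    by (rule infsum_mono2) (use g s in \<open>auto simp: ell2_def\<close>)
  also have "\<dots> = (ell2_norm g)\<^sup>2"
    by (simp add: ell2_norm_def infsum_nonneg)
  finally show ?thesis .
qed

text \<open>Damping a bounded generalised eigenfunction by \<open>decay r\<close> and letting \<open>r \<rightarrow> 1\<close> yields
  a Weyl sequence.\<close>
lemma generalized_eigenfunction_in_spectrum:
  assumes ab: "a \<ge> 0" "b \<ge> 0" "a + b = 1/2"
    and eig: "\<And>v. rot_laplacian a b f v = z * f v"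
    and const: "\<And>j n. cmod (f (j, n)) = cmod (f (j, (0, 0)))"
    and nz: "f (j\<^sub>0, (0, 0)) \<noteq> 0"
  shows "z \<in> op_spectrum ell2 ell2_norm (rot_laplacian a b)"
proof (rule ccontr)
  let ?T = "rot_laplacian a b"
  assume "\<not> ?thesis"
  then obtain C where C: "\<And>f. f \<in> ell2 \<Longrightarrow> ell2_norm f \<le> C * ell2_norm (\<lambda>v. ?T f v - z * f v)"
    unfolding op_spectrum_def by blast
  define c where "c = cmod (f (j\<^sub>0, (0, 0)))"
  have c: "c > 0"
    using nz by (simp add: c_def)
  define M where "M = (\<Sum>j\<in>UNIV. cmod (f (j, (0, 0))))"
  have M: "cmod (f v) \<le> M" for v
  proof -
    have "cmod (f (fst v, (0, 0))) \<le> M"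
      unfolding M_def by (rule member_le_sum) (auto simp: finite_site)
    then show ?thesis
      using const[of "fst v" "snd v"] by simp
  qed
  have "M > 0"
    using order_less_le_trans[OF c, of M] M[of "(j\<^sub>0, (0, 0))"] by (simp only: c_def)
  \<comment> \<open>\<open>C'\<close> is positive and at least \<open>C\<close>, whatever the sign
    of \<open>C\<close>. Then \<open>\<epsilon>\<close> gives
    \<open>C' * (\<epsilon> * M) = c / 2\<close>, so the final estimate has the factor
    \<open>3 * (c / 2)\<^sup>2\<close>, less than \<open>c\<^sup>2\<close>; and \<open>r\<close>
    satisfies \<open>1 / r - 1 = \<epsilon>\<close>.\<close>
  define C' where "C' = \<bar>C\<bar> + 1"
  define \<epsilon> where "\<epsilon> = c / (2 * C' * M)"
  have "\<epsilon> > 0"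
    using c \<open>M > 0\<close> by (simp add: \<epsilon>_def C'_def)
  define r where "r = 1 / (1 + \<epsilon>)"
  have r: "0 < r" "r < 1" and \<epsilon>_eq: "1 / r - 1 = \<epsilon>"
    using \<open>\<epsilon> > 0\<close> by (auto simp: r_def)
  define W where "W = (\<Sum>\<^sub>\<infinity>n. (decay r n)\<^sup>2)"
  have "(\<Sum>n\<in>{(0,0)}. (decay r n)\<^sup>2) \<le> W"
    unfolding W_def using summable_on_decay_sq[OF r] by (intro finite_sum_le_infsum) auto
  then have "W > 0"
    by (simp add: decay_def)
  define h where "h v = of_real (decay r (snd v)) * f v" for v
  define g where "g v = ?T h v - z * h v" for v
  have h: "h \<in> ell2"
    by (rule ell2_decay_bound(1)[OF r, of _ M])
      (use M decay_pos[OF r(1)] in \<open>auto simp: h_def norm_mult mult.commute abs_of_pos\<close>)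
  have "c * decay r n \<le> cmod (h (j\<^sub>0, n))" for n
    using decay_pos[OF r(1), of n] const[of j\<^sub>0 n]
    by (simp add: h_def norm_mult c_def mult.commute abs_of_pos)
  then have lower: "c\<^sup>2 * W \<le> (ell2_norm h)\<^sup>2"
    unfolding W_def by (intro ell2_norm_lower_decay[OF r h]) (use c in auto)
  have g_bound: "cmod (g v) \<le> (\<epsilon> * M) * decay r (snd v)" for v
  proof -
    define k where "k w = of_real (decay r (snd w) - decay r (snd v)) * f w" for w
    have k: "cmod (k w) \<le> \<epsilon> * M * decay r (snd v)"
      if "w \<in> {rotA v, rotA (rotA v), rotB v, rotB (rotB v)}" for w
    proof -
      have "cmod (k w) \<le> (\<epsilon> * decay r (snd v)) * M"
        unfolding k_def norm_mult norm_of_real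
        using decay_rot_diff[OF r that] decay_pos[OF r(1)] \<open>\<epsilon> > 0\<close>
        by (intro mult_mono M) (auto simp: \<epsilon>_eq less_imp_le)
      then show ?thesis
        by (simp add: mult_ac)
    qed
    \<comment> \<open>Subtracting the eigenvalue equation at \<open>v\<close>, scaled by the damping
      there, leaves only differences of the damping factor along edges.\<close>
    have "g v = g v - of_real (decay r (snd v)) * (?T f v - z * f v)"
      by (simp add: eig)
    also have "\<dots> = - (of_real a * (k (rotA v) + k (rotA (rotA v)))
                     + of_real b * (k (rotB v) + k (rotB (rotB v))))"
      by (simp add: g_def h_def k_def rot_laplacian_def algebra_simps)
    finally have g_eq: "g v = \<dots>" .
    have "cmod (g v) \<le> a * (cmod (k (rotA v)) + cmod (k (rotA (rotA v))))
                       + b * (cmod (k (rotB v)) + cmod (k (rotB (rotB v))))"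
      unfolding g_eq norm_minus_cancel using ab
      by (intro order_trans[OF norm_triangle_ineq] add_mono)
        (auto simp: norm_mult intro!: mult_left_mono norm_triangle_ineq)
    also have "\<dots> \<le> a * (\<epsilon> * M * decay r (snd v) + \<epsilon> * M * decay r (snd v))
                       + b * (\<epsilon> * M * decay r (snd v) + \<epsilon> * M * decay r (snd v))"
      using ab by (intro add_mono mult_left_mono k) auto
    also have "\<dots> = 2 * (a + b) * (\<epsilon> * M * decay r (snd v))"
      by (simp add: algebra_simps)
    also have "\<dots> = \<epsilon> * M * decay r (snd v)"
      by (simp add: ab(3))
    finally show ?thesis .
  qed
  have "ell2_norm h \<le> C' * ell2_norm g"
  proof -
    have "C * ell2_norm g \<le> C' * ell2_norm g"
      by (intro mult_right_mono) (auto simp: C'_def ell2_norm_def infsum_nonneg)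
    with C[OF h] show ?thesis
      by (simp add: g_def[abs_def])
  qed
  then have "(ell2_norm h)\<^sup>2 \<le> (C' * ell2_norm g)\<^sup>2"
    by (intro power_mono) (auto simp: ell2_norm_def infsum_nonneg)
  also have "\<dots> \<le> C'\<^sup>2 * (3 * (\<epsilon> * M)\<^sup>2 * W)"
    unfolding power_mult_distrib[of C'] W_def
    by (intro mult_left_mono ell2_decay_bound(2)[OF r g_bound]) auto
  also have "\<dots> = 3 / 4 * (c\<^sup>2 * W)"
  proof -
    have "C' > 0"
      by (simp add: C'_def)
    then have "C' * (\<epsilon> * M) = c / 2"
      using \<open>M > 0\<close> by (simp add: \<epsilon>_def)
    then have "C'\<^sup>2 * (\<epsilon> * M)\<^sup>2 = (c / 2)\<^sup>2"
      by (metis power_mult_distrib)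
    then have "3 * W * (C'\<^sup>2 * (\<epsilon> * M)\<^sup>2) = 3 * W * (c / 2)\<^sup>2"
      by simp
    then show ?thesis
      by (simp add: power_divide mult_ac)
  qed
  finally have "c\<^sup>2 * W \<le> 3 / 4 * (c\<^sup>2 * W)"
    using lower by linarith
  moreover have "c\<^sup>2 * W > 0"
    using c \<open>W > 0\<close> by simp
  ultimately show False
    by linarith
qed

section \<open>Bloch waves and the flat band\<close>

lemma rot_laplacian_alt:
  assumes "a + b = 1/2"
  shows "rot_laplacian a b f v = of_real (3/2) * f v
     - of_real a * (f v + f (rotA v) + f (rotA (rotA v)))
     - of_real b * (f v + f (rotB v) + f (rotB (rotB v)))"
proof -
  have "of_real (3/2) = (1 + of_real (a + b) :: complex)"
    by (simp add: assms)
  then show ?thesis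
    by (simp add: rot_laplacian_def ring_distribs del: of_real_divide)
qed

text \<open>Both triangle sums in \<open>rot_laplacian_alt\<close> vanish. Each triangle has exactly
  one \<open>V1\<close> corner, which indexes the hypotheses; for the other corners the index is
  shifted back to it.\<close>

lemma triangle_free_eigenfunction:
  assumes "a + b = 1/2"
    and "\<And>m n. f (V1, m, n) + f (V2, m + 1, n) + f (V3, m + 1, n) = 0"
    and "\<And>m n. f (V1, m, n) + f (V2, m, n) + f (V3, m, n + 1) = 0"
  shows "rot_laplacian a b f v = of_real (3/2) * f v"
proof -
  have "f v + f (rotA v) + f (rotA (rotA v)) = 0"
  proof (cases v rule: vertex_cases)
    case (1 m n)
    then show ?thesis
      using assms(2)[of m n] by simp
  next
    case (2 m n)
    then show ?thesis
      using assms(2)[of "m - 1" n] by (simp add: add_ac)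
  next
    case (3 m n)
    then show ?thesis
      using assms(2)[of "m - 1" n] by (simp add: add_ac)
  qed
  moreover have "f v + f (rotB v) + f (rotB (rotB v)) = 0"
  proof (cases v rule: vertex_cases)
    case (1 m n)
    then show ?thesis
      using assms(3)[of m n] by simp
  next
    case (2 m n)
    then show ?thesis
      using assms(3)[of m n] by (simp add: add_ac)
  next
    case (3 m n)
    then show ?thesis
      using assms(3)[of m "n - 1"] by (simp add: add_ac)
  qed
  ultimately show ?thesis
    by (simp add: rot_laplacian_alt[OF assms(1)])
qed

text \<open>A periodic function for the trivial quasimomentum, where \<open>hexagon_function\<close>
  degenerates. Each triangle has one corner of each site type, so its sums vanish; being bounded, it
  also puts 3/2 into the spectrum on \<open>ell2\<close>.\<close>

definition band_edge_function :: "vertex \<Rightarrow> complex" where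
  "band_edge_function v = (case fst v of V1 \<Rightarrow> 1 | V2 \<Rightarrow> -1 | V3 \<Rightarrow> 0)"

lemma band_edge_eigenfunction:
  "a + b = 1/2 \<Longrightarrow>
    rot_laplacian a b band_edge_function v = of_real (3/2) * band_edge_function v"
  by (rule triangle_free_eigenfunction) (auto simp: band_edge_function_def)

text \<open>For every \<open>e\<close> the following function sums to zero over each triangle; for \<open>e\<close> a
  point mass it is the alternating function on a hexagon.\<close>
definition hexagon_function :: "(int \<Rightarrow> int \<Rightarrow> complex) \<Rightarrow> vertex \<Rightarrow> complex" where
  "hexagon_function e v = (case v of
     (V1, m, n) \<Rightarrow> e (m + 1) (n + 1) - e (m + 1) n
   | (V2, m, n) \<Rightarrow> e (m + 1) n - e m (n + 1)
   | (V3, m, n) \<Rightarrow> e m n - e (m + 1) n)"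

lemma hexagon_eigenfunction:
  "a + b = 1/2 \<Longrightarrow>
    rot_laplacian a b (hexagon_function e) v = of_real (3/2) * hexagon_function e v"
  by (rule triangle_free_eigenfunction) (auto simp: hexagon_function_def algebra_simps)

text \<open>Each fibre contains a nonzero function of energy 3/2, so the shifted Laplacian is not
  injective there. Inserting the character \<open>e\<close> into \<open>hexagon_function\<close>
  provides it unless \<open>e\<close> is trivial.\<close>

lemma flat_band_if:
  assumes lap: "\<And>f v. laplacian \<mu> \<gamma> f v = rot_laplacian a b f v" and ab: "a + b = 1/2"
  shows "flat_band \<mu> \<gamma> (3/2)"
proof -
  have "\<exists>f\<in>bloch_space \<theta>. f \<noteq> (\<lambda>v. 0) \<and> (\<forall>v. rot_laplacian a b f v = of_real (3/2) * f v)" for \<theta>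
  proof -
    define e where "e m n = exp (\<i> * of_real (\<theta> \<bullet> (real_of_int m, real_of_int n)))" for m n
    have e_add: "e (m + m') (n + n') = e m' n' * e m n" for m n m' n'
      by (simp add: e_def inner_prod_def algebra_simps flip: exp_add)
    have e_00: "e 0 0 = 1"
      by (simp add: e_def inner_prod_def)
    show ?thesis
    proof (cases "e 1 0 = 1 \<and> e 0 1 = 1")
      case False
      have "hexagon_function e (translate \<beta> v) = e (fst \<beta>) (snd \<beta>) * hexagon_function e v" for \<beta> v
      proof -
        obtain p q where \<beta>: "\<beta> = (p, q)"
          by fastforce
        have "e (m + p + 1) (n + q + 1) = e p q * e (m + 1) (n + 1)"
          "e (m + p + 1) (n + q) = e p q * e (m + 1) n"
          "e (m + p) (n + q + 1) = e p q * e m (n + 1)"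
          "e (m + p) (n + q) = e p q * e m n" for m n
          using e_add[of "m + 1" p "n + 1" q] e_add[of "m + 1" p n q] e_add[of m p "n + 1" q]
            e_add[of m p n q] by (simp_all add: ac_simps)
        then show ?thesis
          by (cases v rule: vertex_cases)
            (simp_all add: \<beta> hexagon_function_def translate_def right_diff_distrib)
      qed
      then have "hexagon_function e \<in> bloch_space \<theta>"
        by (simp add: bloch_space_def e_def)
      moreover have "hexagon_function e \<noteq> (\<lambda>v. 0)"
      proof
        assume 0: "hexagon_function e = (\<lambda>v. 0)"
        \<comment> \<open>The values at \<open>V3\<close> and \<open>V2\<close> in the origin cell
          are \<open>1 - e 1 0\<close> and \<open>e 1 0 - e 0 1\<close>.\<close>
        have "e 1 0 = 1" "e 1 0 = e 0 1"
          using fun_cong[OF 0, of "(V3, 0, 0)"] fun_cong[OF 0, of "(V2, 0, 0)"]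
          by (simp_all add: hexagon_function_def e_00)
        with False show False
          by simp
      qed
      ultimately show ?thesis
        using hexagon_eigenfunction[OF ab] by blast
    next
      case True
      have e0: "e (int m) 0 = 1" "e (- int m) 0 = 1" "e 0 (int m) = 1" "e 0 (- int m) = 1" for m
      proof -
        have "e (1 + k) 0 = e k 0" "e 0 (1 + k) = e 0 k" for k
          using e_add[of 1 k 0 0] e_add[of 0 0 1 k] True by simp_all
        then show 1: "e (int m) 0 = 1" "e 0 (int m) = 1"
          by (induction m) (simp_all add: e_00)
        show "e (- int m) 0 = 1" "e 0 (- int m) = 1"
          using e_add[of "int m" "- int m" 0 0] e_add[of 0 0 "int m" "- int m"] 1 e_00 by auto
      qed
      have "e m n = 1" for m n
      proof -
        have "e m 0 = 1" "e 0 n = 1"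
          by (metis e0(1,2) int_cases2, metis e0(3,4) int_cases2)
        then show ?thesis
          using e_add[of m 0 0 n] by simp
      qed
      then have "band_edge_function \<in> bloch_space \<theta>"
        by (simp add: bloch_space_def band_edge_function_def translate_def e_def)
      moreover have "band_edge_function \<noteq> (\<lambda>v. 0)"
        using fun_cong[of band_edge_function "\<lambda>v. 0" "(V1, 0, 0)"]
        by (auto simp: band_edge_function_def)
      ultimately show ?thesis
        using band_edge_eigenfunction[OF ab] by blast
    qed
  qed
  moreover have "z \<in> op_spectrum (bloch_space \<theta>) N (laplacian \<mu> \<gamma>)"
    if "f \<in> bloch_space \<theta>" "f \<noteq> (\<lambda>v. 0)" "\<And>v. rot_laplacian a b f v = z * f v" for f z \<theta> N
  proof -
    have "(\<lambda>v. 0) \<in> bloch_space \<theta>"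
      by (simp add: bloch_space_def)
    moreover have "(\<lambda>v. laplacian \<mu> \<gamma> f v - z * f v) = (\<lambda>v. laplacian \<mu> \<gamma> (\<lambda>v. 0) v - z * 0)"
      by (simp add: lap that(3)) (simp add: rot_laplacian_def)
    ultimately have "\<not> inj_on (\<lambda>f v. laplacian \<mu> \<gamma> f v - z * f v) (bloch_space \<theta>)"
      using inj_onD[of _ "bloch_space \<theta>" f "\<lambda>v. 0"] that(1,2) by blast
    then show ?thesis
      by (auto simp: op_spectrum_def bij_betw_def)
  qed
  ultimately show ?thesis
    unfolding flat_band_def by blast
qed

text \<open>The wave is \<open>X A\<^sup>* e + Y B\<^sup>* e\<close> with \<open>e (m, n) = cis (x (m + 2 n))\<close>, where \<open>A\<close> and \<open>B\<close> sum
  over the triangles of the two orientations. On this line of quasimomenta the off-diagonal symbol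
  of \<open>A B\<^sup>*\<close> is the real number \<open>s\<close>.\<close>
lemma bloch_wave_eigenfunction:
  fixes a b x X Y \<kappa> :: real
  defines "s \<equiv> 1 + 2 * cos x"
  assumes ab: "a + b = 1/2"
    and X: "a * (3 * X + s * Y) = \<kappa> * X" and Y: "b * (3 * Y + s * X) = \<kappa> * Y"
    and nz: "\<kappa> \<noteq> 0" "X \<noteq> 0 \<or> Y \<noteq> 0"
  obtains f j where "\<And>v. rot_laplacian a b f v = of_real (3/2 - \<kappa>) * f v"
    "\<And>j n. cmod (f (j, n)) = cmod (f (j, (0, 0)))" "f (j, (0, 0)) \<noteq> 0"
proof -
  define E where "E k = cis (x * of_int k)" for k :: int
  have E_add: "E (k + l) = E k * E l" for k l
    by (simp add: E_def cis_mult algebra_simps)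
  have E_0: "E 0 = 1"
    by (simp add: E_def)
  \<comment> \<open>A triangle meets three triangles of the other orientation, with phases
    \<open>E k\<close>, \<open>E (k + 1)\<close> and \<open>E (k - 1)\<close>; the last two add up
    to the real multiple \<open>2 * cos x\<close> of \<open>E k\<close>.\<close>
  have E_s: "E k + E (k + 1) + E (k - 1) = of_real s * E k" for k
  proof -
    have "E 1 + E (-1) = of_real (2 * cos x)"
      by (simp add: E_def complex_eq_iff)
    moreover have "E k + E (k + 1) + E (k - 1) = (1 + (E 1 + E (-1))) * E k"
      using E_add[of k 1] E_add[of k "-1"] by (simp add: algebra_simps)
    ultimately show ?thesis
      by (simp add: s_def)
  qed
  define f :: "vertex \<Rightarrow> complex" where "f v = (case v of
       (V1, m, n) \<Rightarrow> of_real X * E (m + 2 * n) + of_real Y * E (m + 2 * n)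
     | (V2, m, n) \<Rightarrow> of_real X * E (m + 2 * n - 1) + of_real Y * E (m + 2 * n)
     | (V3, m, n) \<Rightarrow> of_real X * E (m + 2 * n - 1) + of_real Y * E (m + 2 * n - 2))" for v
  \<comment> \<open>The hypotheses make (X, Y) an eigenvector for \<open>\<kappa>\<close> of the 2 x
    2 matrix with rows (3 a, a s) and (b s, 3 b); \<open>A\<close> and \<open>B\<close> are its two
    rows.\<close>
  have A: "of_real a * (f (V1, m, n) + f (V2, m + 1, n) + f (V3, m + 1, n))
      = of_real (\<kappa> * X) * E (m + 2 * n)" for m n
  proof -
    have "f (V1, m, n) + f (V2, m + 1, n) + f (V3, m + 1, n) = of_real (3 * X) * E (m + 2 * n)
        + of_real Y * (E (m + 2 * n) + E (m + 2 * n + 1) + E (m + 2 * n - 1))"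
      by (simp add: f_def algebra_simps)
    also have "\<dots> = of_real (3 * X + s * Y) * E (m + 2 * n)"
      unfolding E_s by (simp add: algebra_simps)
    finally show ?thesis
      by (simp flip: X)
  qed
  have B: "of_real b * (f (V1, m, n) + f (V2, m, n) + f (V3, m, n + 1))
      = of_real (\<kappa> * Y) * E (m + 2 * n)" for m n
  proof -
    have "f (V1, m, n) + f (V2, m, n) + f (V3, m, n + 1) = of_real (3 * Y) * E (m + 2 * n)
        + of_real X * (E (m + 2 * n) + E (m + 2 * n + 1) + E (m + 2 * n - 1))"
      by (simp add: f_def algebra_simps)
    also have "\<dots> = of_real (3 * Y + s * X) * E (m + 2 * n)"
      unfolding E_s by (simp add: algebra_simps)
    finally show ?thesis
      by (simp flip: Y)
  qed
  have "rot_laplacian a b f v = of_real (3/2 - \<kappa>) * f v" for v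
  proof -
    \<comment> \<open>By construction \<open>f v\<close> is the \<open>X\<close> wave of one
      triangle through \<open>v\<close> plus the \<open>Y\<close> wave of the other, so
      \<open>A\<close> and \<open>B\<close> add up to \<open>\<kappa>\<close> times
      \<open>f v\<close>.\<close>
    have "of_real a * (f v + f (rotA v) + f (rotA (rotA v)))
        + of_real b * (f v + f (rotB v) + f (rotB (rotB v))) = of_real \<kappa> * f v"
    proof (cases v rule: vertex_cases)
      case (1 m n)
      then show ?thesis
        using A[of m n] B[of m n] by (simp add: f_def algebra_simps)
    next
      case (2 m n)
      then show ?thesis
        using A[of "m - 1" n] B[of m n] by (simp add: f_def algebra_simps)
    next
      case (3 m n)
      then show ?thesis
        using A[of "m - 1" n] B[of m "n - 1"] by (simp add: f_def algebra_simps)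
    qed
    then show ?thesis
      unfolding rot_laplacian_alt[OF ab] by (simp add: algebra_simps)
  qed
  moreover have "cmod (f (j, n)) = cmod (f (j, (0, 0)))" for j n
  proof -
    obtain p q where n: "n = (p, q)"
      by fastforce
    have "f (j, n) = E (p + 2 * q) * f (j, (0, 0))"
      using E_add[of "p + 2 * q" "-1"] E_add[of "p + 2 * q" "-2"] E_add[of "p + 2 * q" 0]
      by (cases j) (simp_all add: f_def n E_0 algebra_simps)
    then show ?thesis
      by (simp add: norm_mult E_def)
  qed
  moreover have "\<exists>j. f (j, (0, 0)) \<noteq> 0"
  proof (rule ccontr)
    assume "\<not> ?thesis"
    then have "f v = 0" for v
      using \<open>\<And>j n. cmod (f (j, n)) = cmod (f (j, (0, 0)))\<close>[of "fst v" "snd v"] by simp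
    then have "\<kappa> * X = 0" "\<kappa> * Y = 0"
      using A[of 0 0] B[of 0 0] by (simp_all add: E_def)
    with nz show False
      by simp
  qed
  ultimately show thesis
    using that by blast
qed

section \<open>Every energy of the bands is attained\<close>

text \<open>With t = 3/2 - \<kappa>, a Bloch wave exists once the characteristic equation (\<kappa>
  - 3 a)(\<kappa> - 3 b) = a b s^2 holds. Inside the bands it has a solution s in [0, 3], a value of
  1 + 2 cos x. The energy 3/2, where \<kappa> = 0, is left to
  \<open>band_edge_function\<close>.\<close>

lemma spectrum_rot_laplacian_superset:
  assumes ab: "a > 0" "b > 0" "a + b = 1/2"
    and t: "\<bar>3 * a - 3/4\<bar> \<le> \<bar>t - 3/4\<bar>" "\<bar>t - 3/4\<bar> \<le> 3/4"
  shows "of_real t \<in> op_spectrum ell2 ell2_norm (rot_laplacian a b)"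
proof (cases "t = 3/2")
  case True
  have "of_real (3/2) \<in> op_spectrum ell2 ell2_norm (rot_laplacian a b)"
    by (rule generalized_eigenfunction_in_spectrum[OF _ _ ab(3) band_edge_eigenfunction[OF ab(3)],
          where j\<^sub>0 = V1]) (use ab in \<open>auto simp: band_edge_function_def\<close>)
  then show ?thesis
    by (simp add: True)
next
  case False
  define \<kappa> where "\<kappa> = 3/2 - t"
  have b: "b = 1/2 - a"
    using ab by simp
  define r where "r = sqrt ((\<kappa> - 3 * a) * (\<kappa> - 3 * b) / (a * b))"
  \<comment> \<open>The first bound on \<open>t\<close> makes this nonnegative; the second bounds it
    by 9 a b, which is (3/4)^2 - (3 a - 3/4)^2.\<close>
  have eq: "(\<kappa> - 3 * a) * (\<kappa> - 3 * b) = (t - 3/4)\<^sup>2 - (3 * a - 3/4)\<^sup>2"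
    by (simp add: \<kappa>_def b power2_eq_square field_simps)
  have nonneg: "(\<kappa> - 3 * a) * (\<kappa> - 3 * b) \<ge> 0"
    unfolding eq using t(1) by (simp add: abs_le_square_iff)
  have "(t - 3/4)\<^sup>2 \<le> (3/4)\<^sup>2"
    using t(2) by (subst abs_le_square_iff[symmetric]) simp
  then have "(\<kappa> - 3 * a) * (\<kappa> - 3 * b) \<le> 9 * (a * b)"
    unfolding eq by (simp add: b power2_eq_square field_simps)
  then have r: "0 \<le> r" "r \<le> 3"
    using nonneg ab by (auto simp: r_def divide_le_eq intro!: real_le_lsqrt)
  have r2: "a * b * r\<^sup>2 = (\<kappa> - 3 * a) * (\<kappa> - 3 * b)"
    using nonneg ab by (simp add: r_def)
  define x where "x = arccos ((r - 1) / 2)"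
  have s: "1 + 2 * cos x = r"
    unfolding x_def using r by (subst cos_arccos) (auto simp: field_simps)
  obtain X Y where XY: "a * (3 * X + r * Y) = \<kappa> * X" "b * (3 * Y + r * X) = \<kappa> * Y" "X \<noteq> 0 \<or> Y \<noteq> 0"
  proof (cases "r = 0 \<and> \<kappa> = 3 * a")
    case True
    then show thesis
      using that[of 1 0] by simp
  next
    case False
    \<comment> \<open>This vector satisfies the first row identically and the second by
      \<open>r2\<close>; it vanishes only in the case treated before.\<close>
    show thesis
    proof (rule that[of "a * r" "\<kappa> - 3 * a"])
      show "a * (3 * (a * r) + r * (\<kappa> - 3 * a)) = \<kappa> * (a * r)"
        by (simp add: algebra_simps)
      show "b * (3 * (\<kappa> - 3 * a) + r * (a * r)) = \<kappa> * (\<kappa> - 3 * a)"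
        using r2 by (simp add: algebra_simps power2_eq_square)
      show "a * r \<noteq> 0 \<or> \<kappa> - 3 * a \<noteq> 0"
        using False ab by auto
    qed
  qed
  obtain f j where f: "\<And>v. rot_laplacian a b f v = of_real (3/2 - \<kappa>) * f v"
    "\<And>j n. cmod (f (j, n)) = cmod (f (j, (0, 0)))" "f (j, (0, 0)) \<noteq> 0"
    by (rule bloch_wave_eigenfunction[OF ab(3), where x = x and X = X and Y = Y and \<kappa> = \<kappa>])
      (use XY False in \<open>auto simp: s \<kappa>_def\<close>)
  have "of_real (3/2 - \<kappa>) \<in> op_spectrum ell2 ell2_norm (rot_laplacian a b)"
    by (rule generalized_eigenfunction_in_spectrum[OF _ _ ab(3) f]) (use ab in auto)
  then show ?thesis
    by (simp add: \<kappa>_def)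
qed

theorem theorem8:
  fixes \<mu> \<alpha> \<beta> :: real and \<gamma> :: "nat \<Rightarrow> real"
  assumes "\<mu> > 0" and "\<alpha> > 0" and "\<beta> > 0" and "2 * (\<alpha> + \<beta>) = \<mu>"
    and "\<gamma> 2 = \<alpha>" and "\<gamma> 4 = \<alpha>" and "\<gamma> 6 = \<alpha>"
    and "\<gamma> 1 = \<beta>" and "\<gamma> 3 = \<beta>" and "\<gamma> 5 = \<beta>"
  shows "op_spectrum ell2 ell2_norm (laplacian \<mu> \<gamma>) =
           complex_of_real `
             ({0 .. 3/4 - \<bar>3 * \<alpha> / \<mu> - 3/4\<bar>} \<union> {3/4 + \<bar>3 * \<alpha> / \<mu> - 3/4\<bar> .. 3/2})
         \<and> flat_band \<mu> \<gamma> (3/2)"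
proof
  define a b where "a = \<alpha> / \<mu>" and "b = \<beta> / \<mu>"
  have ab: "a > 0" "b > 0" "a + b = 1/2"
    using assms(1-4) by (auto simp: a_def b_def field_simps)
  have lap: "laplacian \<mu> \<gamma> f v = rot_laplacian a b f v" for f v
    unfolding rot_laplacian_def a_def b_def by (rule laplacian_eq_rot) (use assms in auto)
  then have lap_eq: "laplacian \<mu> \<gamma> = rot_laplacian a b"
    by blast
  show "flat_band \<mu> \<gamma> (3/2)"
    using flat_band_if[OF lap ab(3)] .
  have bands: "t \<in> {0 .. 3/4 - \<bar>3 * \<alpha> / \<mu> - 3/4\<bar>} \<union> {3/4 + \<bar>3 * \<alpha> / \<mu> - 3/4\<bar> .. 3/2}
      \<longleftrightarrow> \<bar>3 * a - 3/4\<bar> \<le> \<bar>t - 3/4\<bar> \<and> \<bar>t - 3/4\<bar> \<le> 3/4" for t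
  proof -
    have "3 * \<alpha> / \<mu> = 3 * a"
      by (simp add: a_def)
    then show ?thesis
      using ab by (auto simp: abs_if split: if_splits)
  qed
  show "op_spectrum ell2 ell2_norm (laplacian \<mu> \<gamma>) = complex_of_real `
      ({0 .. 3/4 - \<bar>3 * \<alpha> / \<mu> - 3/4\<bar>} \<union> {3/4 + \<bar>3 * \<alpha> / \<mu> - 3/4\<bar> .. 3/2})"
    unfolding lap_eq
  proof (intro equalityI subsetI)
    fix z assume "z \<in> op_spectrum ell2 ell2_norm (rot_laplacian a b)"
    then obtain t where "z = of_real t" "\<bar>3 * a - 3/4\<bar> \<le> \<bar>t - 3/4\<bar>" "\<bar>t - 3/4\<bar> \<le> 3/4"
      using spectrum_two_rotations_subset[of rotA rotB a b "rot_laplacian a b" z] ab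
      by (auto simp: rot_laplacian_def)
    then show "z \<in> complex_of_real `
        ({0 .. 3/4 - \<bar>3 * \<alpha> / \<mu> - 3/4\<bar>} \<union> {3/4 + \<bar>3 * \<alpha> / \<mu> - 3/4\<bar> .. 3/2})"
      using bands by blast
  next
    fix z assume "z \<in> complex_of_real `
        ({0 .. 3/4 - \<bar>3 * \<alpha> / \<mu> - 3/4\<bar>} \<union> {3/4 + \<bar>3 * \<alpha> / \<mu> - 3/4\<bar> .. 3/2})"
    then obtain t where "z = of_real t" "\<bar>3 * a - 3/4\<bar> \<le> \<bar>t - 3/4\<bar>" "\<bar>t - 3/4\<bar> \<le> 3/4"
      using bands by blast
    then show "z \<in> op_spectrum ell2 ell2_norm (rot_laplacian a b)"
      using spectrum_rot_laplacian_superset[OF ab] by blast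
  qed
qed

end
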